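(* Let $G$ be a finite group and $M$ a $\mathbb{Z}_{\geq 0}[G]$-module. Then the following conditions are equivalent: (i) $M$ is minimal; (ii) $M$ is elementary; (iii) $M$ is simple; (iv) $M$ is the restriction to $\mathbb{Z}_{\geq 0}[G]$ of a simple $\mathbb{Z}[G]$-module.
   Context: A semiring is a tuple $(R,+,\cdot,0,1)$ where $(R,+,0)$ is a commutative monoid, $(R,\cdot,1)$ is a monoid, multiplication distributes over addition on both sides, and $0a=a0=0$ for all $a\in R$. A (left) $R$-semimodule is a commutative monoid $(M,+,0_M)$ with a map $R\times M\to M$, $(r,m)\mapsto r(m)$, such that $r(m+n)=r(m)+r(n)$, $r(0_M)=0_M$, $(r+s)(m)=r(m)+s(m)$, $(rs)(m)=r(s(m))$, $0(m)=0_M$, $1(m)=m$. It is called an $R$-module if $M$ is an abelian group. A subsemimodule is a submonoid closed under the action of $R$. An $R$-congruence on $M$ is an equivalence relation $\sim$ such that $m\sim n$ implies $m+k\sim n+k$ for all $k\in M$ and $r(m)\sim r(n)$ for all $r\in R$. A non-zero $R$-semimodule $M$ is called minimal if its only subsemimodules are $\{0_M\}$ and $M$; elementary if its only $R$-congruences are the equality relation and the full relation $M\times M$; simple if it is both minimal and elementary. $\mathbb{Z}_{\geq 0}[G]$ is the group semiring of $G$ over the non-negative integers, a subsemiring of the group ring $\mathbb{Z}[G]$; restriction is along this inclusion. *)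

theory Defs
  imports "HOL-Algebra.Module"
begin

section \<open>Semimodules over a semiring\<close>

text \<open>
  The record type \<open>module\<close> of the library is reused for the data of a semimodule; its fields
  \<open>mult\<close> and \<open>one\<close> play no role. The library locale \<open>module\<close> itself is not applicable, because it
  requires commutative rings of scalars.
\<close>

locale semimodule = R?: semiring R + M?: abelian_monoid M
  for R (structure) and M :: "('a, 'm, 'x) module_scheme" (structure) +
  assumes smult_closed [simp, intro]:
      "\<lbrakk> r \<in> carrier R; m \<in> carrier M \<rbrakk> \<Longrightarrow> r \<odot>\<^bsub>M\<^esub> m \<in> carrier M"
    and smult_r_distr:
      "\<lbrakk> r \<in> carrier R; m \<in> carrier M; n \<in> carrier M \<rbrakk> \<Longrightarrow>
        r \<odot>\<^bsub>M\<^esub> (m \<oplus>\<^bsub>M\<^esub> n) = r \<odot>\<^bsub>M\<^esub> m \<oplus>\<^bsub>M\<^esub> r \<odot>\<^bsub>M\<^esub> n"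
    and smult_r_null: "r \<in> carrier R \<Longrightarrow> r \<odot>\<^bsub>M\<^esub> \<zero>\<^bsub>M\<^esub> = \<zero>\<^bsub>M\<^esub>"
    and smult_l_distr:
      "\<lbrakk> r \<in> carrier R; s \<in> carrier R; m \<in> carrier M \<rbrakk> \<Longrightarrow>
        (r \<oplus>\<^bsub>R\<^esub> s) \<odot>\<^bsub>M\<^esub> m = r \<odot>\<^bsub>M\<^esub> m \<oplus>\<^bsub>M\<^esub> s \<odot>\<^bsub>M\<^esub> m"
    and smult_assoc:
      "\<lbrakk> r \<in> carrier R; s \<in> carrier R; m \<in> carrier M \<rbrakk> \<Longrightarrow>
        (r \<otimes>\<^bsub>R\<^esub> s) \<odot>\<^bsub>M\<^esub> m = r \<odot>\<^bsub>M\<^esub> (s \<odot>\<^bsub>M\<^esub> m)"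
    and smult_l_null: "m \<in> carrier M \<Longrightarrow> \<zero>\<^bsub>R\<^esub> \<odot>\<^bsub>M\<^esub> m = \<zero>\<^bsub>M\<^esub>"
    and smult_one: "m \<in> carrier M \<Longrightarrow> \<one>\<^bsub>R\<^esub> \<odot>\<^bsub>M\<^esub> m = m"

locale semiring_module = semimodule R M + abelian_group M
  for R (structure) and M :: "('a, 'm, 'x) module_scheme" (structure)

definition subsemimodule ::
  "'m set \<Rightarrow> ('a, 'r) ring_scheme \<Rightarrow> ('a, 'm, 'x) module_scheme \<Rightarrow> bool" where
  "subsemimodule N R M \<longleftrightarrow>
     submonoid N (add_monoid M) \<and> (\<forall>r\<in>carrier R. \<forall>n\<in>N. r \<odot>\<^bsub>M\<^esub> n \<in> N)"

definition semimodule_congruence ::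
  "('a, 'r) ring_scheme \<Rightarrow> ('a, 'm, 'x) module_scheme \<Rightarrow> ('m \<times> 'm) set \<Rightarrow> bool" where
  "semimodule_congruence R M E \<longleftrightarrow>
     equiv (carrier M) E \<and>
     (\<forall>m n. (m, n) \<in> E \<longrightarrow>
        (\<forall>k\<in>carrier M. (m \<oplus>\<^bsub>M\<^esub> k, n \<oplus>\<^bsub>M\<^esub> k) \<in> E) \<and>
        (\<forall>r\<in>carrier R. (r \<odot>\<^bsub>M\<^esub> m, r \<odot>\<^bsub>M\<^esub> n) \<in> E))"

definition minimal_semimodule ::
  "('a, 'r) ring_scheme \<Rightarrow> ('a, 'm, 'x) module_scheme \<Rightarrow> bool" where
  "minimal_semimodule R M \<longleftrightarrow>
     semimodule R M \<and> carrier M \<noteq> {\<zero>\<^bsub>M\<^esub>} \<and>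
     (\<forall>N. subsemimodule N R M \<longrightarrow> N = {\<zero>\<^bsub>M\<^esub>} \<or> N = carrier M)"

definition elementary_semimodule ::
  "('a, 'r) ring_scheme \<Rightarrow> ('a, 'm, 'x) module_scheme \<Rightarrow> bool" where
  "elementary_semimodule R M \<longleftrightarrow>
     semimodule R M \<and> carrier M \<noteq> {\<zero>\<^bsub>M\<^esub>} \<and>
     (\<forall>E. semimodule_congruence R M E \<longrightarrow>
        E = Id_on (carrier M) \<or> E = carrier M \<times> carrier M)"

definition simple_semimodule ::
  "('a, 'r) ring_scheme \<Rightarrow> ('a, 'm, 'x) module_scheme \<Rightarrow> bool" where
  "simple_semimodule R M \<longleftrightarrow> minimal_semimodule R M \<and> elementary_semimodule R M"

text \<open>
  For a subsemiring \<open>S\<close> of the scalars acting on \<open>N\<close>, the semimodule \<open>M\<close> over \<open>S\<close> is the restriction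
  of \<open>N\<close> to \<open>S\<close>. The operations are total functions on the underlying types, so they are compared
  only on the carriers.
\<close>

definition is_restriction_of_scalars ::
  "('a, 'r) ring_scheme \<Rightarrow> ('a, 'm, 'x) module_scheme \<Rightarrow> ('a, 'm, 'y) module_scheme \<Rightarrow> bool" where
  "is_restriction_of_scalars S M N \<longleftrightarrow>
     carrier M = carrier N \<and> \<zero>\<^bsub>M\<^esub> = \<zero>\<^bsub>N\<^esub> \<and>
     (\<forall>m\<in>carrier M. \<forall>n\<in>carrier M. m \<oplus>\<^bsub>M\<^esub> n = m \<oplus>\<^bsub>N\<^esub> n) \<and>
     (\<forall>s\<in>carrier S. \<forall>m\<in>carrier M. s \<odot>\<^bsub>M\<^esub> m = s \<odot>\<^bsub>N\<^esub> m)"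


section \<open>The group ring over the integers and its semiring of non-negative elements\<close>

text \<open>
  A formal sum is represented by its coefficient function, extended by \<open>0\<close> outside the carrier
  of the group. The product is the convolution
  \<open>(f g)(x) = \<Sum>\<^sub>y f(y) g(y\<^sup>-\<^sup>1 x)\<close>, where only the finitely many \<open>y\<close> with \<open>f(y) \<noteq> 0\<close> contribute.
\<close>

definition int_group_ring :: "('g, 'b) monoid_scheme \<Rightarrow> ('g \<Rightarrow> int) ring" where
  "int_group_ring G =
     \<lparr>carrier = {f. finite {x. f x \<noteq> 0} \<and> {x. f x \<noteq> 0} \<subseteq> carrier G},
      monoid.mult = (\<lambda>f g x. if x \<in> carrier G
         then \<Sum>y | f y \<noteq> 0. f y * g (inv\<^bsub>G\<^esub> y \<otimes>\<^bsub>G\<^esub> x) else 0),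
      one = (\<lambda>x. if x = \<one>\<^bsub>G\<^esub> then 1 else 0),
      zero = (\<lambda>x. 0),
      add = (\<lambda>f g x. f x + g x)\<rparr>"

definition nonneg_group_semiring :: "('g, 'b) monoid_scheme \<Rightarrow> ('g \<Rightarrow> int) ring" where
  "nonneg_group_semiring G =
     int_group_ring G \<lparr>carrier := {f \<in> carrier (int_group_ring G). \<forall>x. 0 \<le> f x}\<rparr>"

context group
begin

lemma int_group_ring_mult:
  assumes "finite F" "{y. f y \<noteq> 0} \<subseteq> F" "x \<in> carrier G"
  shows "(f \<otimes>\<^bsub>int_group_ring G\<^esub> g) x = (\<Sum>y\<in>F. f y * g (inv y \<otimes> x))"
  using assms by (auto simp: int_group_ring_def intro!: sum.mono_neutral_left)

lemma int_group_ring_mult_outside: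
  "x \<notin> carrier G \<Longrightarrow> (f \<otimes>\<^bsub>int_group_ring G\<^esub> g) x = 0"
  by (simp add: int_group_ring_def)

lemma int_group_ring_mult_support:
  assumes f: "f \<in> carrier (int_group_ring G)"
  shows "{x. (f \<otimes>\<^bsub>int_group_ring G\<^esub> g) x \<noteq> 0} \<subseteq>
    (\<lambda>(y, z). y \<otimes> z) ` ({y. f y \<noteq> 0} \<times> {z. g z \<noteq> 0})"
proof
  fix x assume "x \<in> {x. (f \<otimes>\<^bsub>int_group_ring G\<^esub> g) x \<noteq> 0}"
  then have nz: "(f \<otimes>\<^bsub>int_group_ring G\<^esub> g) x \<noteq> 0" by simp
  then have x: "x \<in> carrier G" using int_group_ring_mult_outside by blast
  with nz have "(\<Sum>y | f y \<noteq> 0. f y * g (inv y \<otimes> x)) \<noteq> 0"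
    by (simp add: int_group_ring_def)
  then obtain y where "f y * g (inv y \<otimes> x) \<noteq> 0"
    by (rule sum.not_neutral_contains_not_neutral)
  then have y: "f y \<noteq> 0" "g (inv y \<otimes> x) \<noteq> 0" by simp_all
  with f have "y \<in> carrier G" by (auto simp: int_group_ring_def)
  with x have "y \<otimes> (inv y \<otimes> x) = x" by (simp flip: m_assoc)
  then show "x \<in> (\<lambda>(y, z). y \<otimes> z) ` ({y. f y \<noteq> 0} \<times> {z. g z \<noteq> 0})"
    using y by (intro image_eqI[where x = "(y, inv y \<otimes> x)"]) simp_all
qed

lemma int_group_ring_mult_closed:
  assumes f: "f \<in> carrier (int_group_ring G)" and g: "g \<in> carrier (int_group_ring G)"
  shows "f \<otimes>\<^bsub>int_group_ring G\<^esub> g \<in> carrier (int_group_ring G)"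
proof -
  have "finite ((\<lambda>(y, z). y \<otimes> z) ` ({y. f y \<noteq> 0} \<times> {z. g z \<noteq> 0}))"
    using f g by (intro finite_imageI finite_cartesian_product) (auto simp: int_group_ring_def)
  then have "finite {x. (f \<otimes>\<^bsub>int_group_ring G\<^esub> g) x \<noteq> 0}"
    using int_group_ring_mult_support[OF f] finite_subset by blast
  moreover have "{x. (f \<otimes>\<^bsub>int_group_ring G\<^esub> g) x \<noteq> 0} \<subseteq> carrier G"
    using int_group_ring_mult_outside by blast
  ultimately show ?thesis by (simp add: int_group_ring_def)
qed

lemma int_group_ring_mult_assoc:
  assumes f: "f \<in> carrier (int_group_ring G)" and g: "g \<in> carrier (int_group_ring G)"
    and h: "h \<in> carrier (int_group_ring G)"
  shows "(f \<otimes>\<^bsub>int_group_ring G\<^esub> g) \<otimes>\<^bsub>int_group_ring G\<^esub> h =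
    f \<otimes>\<^bsub>int_group_ring G\<^esub> (g \<otimes>\<^bsub>int_group_ring G\<^esub> h)"
proof
  fix x
  let ?m = "\<lambda>a b. a \<otimes>\<^bsub>int_group_ring G\<^esub> b"
  define A where "A = {y. f y \<noteq> 0}"
  define B where "B = {y. g y \<noteq> 0}"
  define P where "P = (\<lambda>(y, z). y \<otimes> z) ` (A \<times> B)"
  have A: "finite A" "A \<subseteq> carrier G" and B: "finite B" "B \<subseteq> carrier G"
    using f g by (auto simp: A_def B_def int_group_ring_def)
  then have P: "finite P" "P \<subseteq> carrier G" by (auto simp: P_def)
  show "?m (?m f g) h x = ?m f (?m g h) x"
  proof (cases "x \<in> carrier G")
    case False
    then show ?thesis by (simp add: int_group_ring_mult_outside)
  next
    case x: True
    have inner: "(\<Sum>z\<in>P. g (inv y \<otimes> z) * h (inv z \<otimes> x)) = ?m g h (inv y \<otimes> x)"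
      if y: "y \<in> A" for y
    proof -
      have yG: "y \<in> carrier G" using y A by auto
      have "?m g h (inv y \<otimes> x) = (\<Sum>w\<in>B. g w * h (inv w \<otimes> (inv y \<otimes> x)))"
        by (rule int_group_ring_mult) (use B x yG in \<open>auto simp: B_def\<close>)
      also have "\<dots> = (\<Sum>w\<in>B. g (inv y \<otimes> (y \<otimes> w)) * h (inv (y \<otimes> w) \<otimes> x))"
      proof (rule sum.cong[OF refl])
        fix w assume "w \<in> B"
        then have w: "w \<in> carrier G" using B by auto
        have "inv y \<otimes> (y \<otimes> w) = w" using w yG by (simp flip: m_assoc)
        moreover have "inv (y \<otimes> w) \<otimes> x = inv w \<otimes> (inv y \<otimes> x)"
          using w x yG by (simp add: inv_mult_group m_assoc)
        ultimately show "g w * h (inv w \<otimes> (inv y \<otimes> x)) =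
            g (inv y \<otimes> (y \<otimes> w)) * h (inv (y \<otimes> w) \<otimes> x)"
          by simp
      qed
      also have "\<dots> = (\<Sum>z\<in>(\<lambda>w. y \<otimes> w) ` B. g (inv y \<otimes> z) * h (inv z \<otimes> x))"
      proof (rule sum.reindex[symmetric, unfolded comp_def])
        show "inj_on (\<lambda>w. y \<otimes> w) B"
          by (rule inj_on_inverseI[where g = "\<lambda>z. inv y \<otimes> z"])
            (use B yG in \<open>simp add: subset_iff flip: m_assoc\<close>)
      qed
      also have "\<dots> = (\<Sum>z\<in>P. g (inv y \<otimes> z) * h (inv z \<otimes> x))"
      proof (rule sum.mono_neutral_left)
        show "finite P" by (fact P(1))
        show "(\<lambda>w. y \<otimes> w) ` B \<subseteq> P" using y unfolding P_def by force
        show "\<forall>z\<in>P - (\<lambda>w. y \<otimes> w) ` B. g (inv y \<otimes> z) * h (inv z \<otimes> x) = 0"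
        proof
          fix z assume z: "z \<in> P - (\<lambda>w. y \<otimes> w) ` B"
          then have "z \<in> carrier G" using P by auto
          then have "y \<otimes> (inv y \<otimes> z) = z" using yG by (simp flip: m_assoc)
          with z have "inv y \<otimes> z \<notin> B" by (metis DiffD2 image_eqI)
          then show "g (inv y \<otimes> z) * h (inv z \<otimes> x) = 0" by (simp add: B_def)
        qed
      qed
      finally show ?thesis by simp
    qed
    have "?m (?m f g) h x = (\<Sum>z\<in>P. ?m f g z * h (inv z \<otimes> x))"
    proof (rule int_group_ring_mult[OF P(1) _ x])
      show "{z. ?m f g z \<noteq> 0} \<subseteq> P"
        unfolding P_def A_def B_def by (rule int_group_ring_mult_support[OF f])
    qed
    also have "\<dots> = (\<Sum>z\<in>P. (\<Sum>y\<in>A. f y * g (inv y \<otimes> z)) * h (inv z \<otimes> x))"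
    proof (rule sum.cong[OF refl])
      fix z assume "z \<in> P"
      then have "z \<in> carrier G" using P by auto
      then show "?m f g z * h (inv z \<otimes> x) =
          (\<Sum>y\<in>A. f y * g (inv y \<otimes> z)) * h (inv z \<otimes> x)"
        using int_group_ring_mult[of A f z g] A by (simp add: A_def)
    qed
    also have "\<dots> = (\<Sum>z\<in>P. \<Sum>y\<in>A. f y * (g (inv y \<otimes> z) * h (inv z \<otimes> x)))"
      by (simp add: sum_distrib_right mult.assoc)
    also have "\<dots> = (\<Sum>y\<in>A. \<Sum>z\<in>P. f y * (g (inv y \<otimes> z) * h (inv z \<otimes> x)))"
      by (rule sum.swap)
    also have "\<dots> = (\<Sum>y\<in>A. f y * ?m g h (inv y \<otimes> x))"
      by (simp add: sum_distrib_left[symmetric] inner)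
    also have "\<dots> = ?m f (?m g h) x"
      using int_group_ring_mult[of A f x "?m g h"] A x by (simp add: A_def)
    finally show ?thesis .
  qed
qed

lemma ring_int_group_ring: "ring (int_group_ring G)"
proof (rule ringI)
  let ?R = "int_group_ring G"
  have add: "f \<oplus>\<^bsub>?R\<^esub> g = (\<lambda>x. f x + g x)" for f g by (simp add: int_group_ring_def)
  have add_closed: "f \<oplus>\<^bsub>?R\<^esub> g \<in> carrier ?R" if "f \<in> carrier ?R" "g \<in> carrier ?R" for f g
  proof -
    have sub: "{x. f x + g x \<noteq> 0} \<subseteq> {x. f x \<noteq> 0} \<union> {x. g x \<noteq> 0}" by auto
    have "finite {x. f x + g x \<noteq> 0}"
      by (rule finite_subset[OF sub]) (use that in \<open>simp add: int_group_ring_def\<close>)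
    moreover have "{x. f x + g x \<noteq> 0} \<subseteq> carrier G"
      using sub that by (force simp: int_group_ring_def)
    ultimately show ?thesis by (simp add: int_group_ring_def)
  qed
  show "abelian_group ?R"
  proof (rule abelian_groupI)
    fix f assume f: "f \<in> carrier ?R"
    show "\<exists>g\<in>carrier ?R. g \<oplus>\<^bsub>?R\<^esub> f = \<zero>\<^bsub>?R\<^esub>"
      by (rule bexI[of _ "\<lambda>x. - f x"]) (use f in \<open>auto simp: int_group_ring_def\<close>)
  qed (simp_all add: add_closed, simp_all add: int_group_ring_def ac_simps)
  show "monoid ?R"
  proof (rule monoidI)
    have "{x. \<one>\<^bsub>?R\<^esub> x \<noteq> 0} = {\<one>}" by (auto simp: int_group_ring_def)
    then show "\<one>\<^bsub>?R\<^esub> \<in> carrier ?R" by (simp add: int_group_ring_def)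
    fix f assume f: "f \<in> carrier ?R"
    show "\<one>\<^bsub>?R\<^esub> \<otimes>\<^bsub>?R\<^esub> f = f"
    proof
      fix x show "(\<one>\<^bsub>?R\<^esub> \<otimes>\<^bsub>?R\<^esub> f) x = f x"
      proof (cases "x \<in> carrier G")
        case True
        then show ?thesis
          by (subst int_group_ring_mult[where F = "{\<one>}"]) (auto simp: int_group_ring_def)
      next
        case False
        with f show ?thesis by (auto simp: int_group_ring_def)
      qed
    qed
    show "f \<otimes>\<^bsub>?R\<^esub> \<one>\<^bsub>?R\<^esub> = f"
    proof
      fix x show "(f \<otimes>\<^bsub>?R\<^esub> \<one>\<^bsub>?R\<^esub>) x = f x"
      proof (cases "x \<in> carrier G")
        case True
        have fin: "finite {y. f y \<noteq> 0}" and sub: "{y. f y \<noteq> 0} \<subseteq> carrier G"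
          using f by (auto simp: int_group_ring_def)
        have "(f \<otimes>\<^bsub>?R\<^esub> \<one>\<^bsub>?R\<^esub>) x = (\<Sum>y | f y \<noteq> 0. f y * (if inv y \<otimes> x = \<one> then 1 else 0))"
          using True by (simp add: int_group_ring_def)
        also have "\<dots> = (\<Sum>y | f y \<noteq> 0. if y = x then f y else 0)"
        proof (rule sum.cong[OF refl])
          fix y assume "y \<in> {y. f y \<noteq> 0}"
          then have y: "y \<in> carrier G" using sub by auto
          have "inv y \<otimes> x = \<one> \<longleftrightarrow> y = x"
            using y True by (metis inv_closed inv_equality inv_inv l_inv)
          then show "f y * (if inv y \<otimes> x = \<one> then 1 else 0) = (if y = x then f y else 0)" by simp
        qed
        also have "\<dots> = f x" using fin by simp
        finally show ?thesis .
      next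
        case False
        with f show ?thesis by (auto simp: int_group_ring_def)
      qed
    qed
  qed (simp_all add: int_group_ring_mult_closed int_group_ring_mult_assoc)
next
  let ?R = "int_group_ring G"
  fix f g h assume fgh: "f \<in> carrier ?R" "g \<in> carrier ?R" "h \<in> carrier ?R"
  show "h \<otimes>\<^bsub>?R\<^esub> (f \<oplus>\<^bsub>?R\<^esub> g) = h \<otimes>\<^bsub>?R\<^esub> f \<oplus>\<^bsub>?R\<^esub> h \<otimes>\<^bsub>?R\<^esub> g"
    by (auto simp: int_group_ring_def algebra_simps sum.distrib)
  show "(f \<oplus>\<^bsub>?R\<^esub> g) \<otimes>\<^bsub>?R\<^esub> h = f \<otimes>\<^bsub>?R\<^esub> h \<oplus>\<^bsub>?R\<^esub> g \<otimes>\<^bsub>?R\<^esub> h"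
  proof
    fix x
    define F where "F = {y. f y \<noteq> 0} \<union> {y. g y \<noteq> 0}"
    have F: "finite F" using fgh by (auto simp: F_def int_group_ring_def)
    have add: "(a \<oplus>\<^bsub>?R\<^esub> b) y = a y + b y" for a b y by (simp add: int_group_ring_def)
    show "((f \<oplus>\<^bsub>?R\<^esub> g) \<otimes>\<^bsub>?R\<^esub> h) x = (f \<otimes>\<^bsub>?R\<^esub> h \<oplus>\<^bsub>?R\<^esub> g \<otimes>\<^bsub>?R\<^esub> h) x"
    proof (cases "x \<in> carrier G")
      case True
      have "((f \<oplus>\<^bsub>?R\<^esub> g) \<otimes>\<^bsub>?R\<^esub> h) x = (\<Sum>y\<in>F. (f y + g y) * h (inv y \<otimes> x))"
        by (subst int_group_ring_mult[where F = F]) (use F True in \<open>auto simp: F_def add\<close>)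
      moreover have "(f \<otimes>\<^bsub>?R\<^esub> h) x = (\<Sum>y\<in>F. f y * h (inv y \<otimes> x))"
        "(g \<otimes>\<^bsub>?R\<^esub> h) x = (\<Sum>y\<in>F. g y * h (inv y \<otimes> x))"
        by (subst int_group_ring_mult[where F = F]; use F True in \<open>auto simp: F_def\<close>)+
      ultimately show ?thesis by (simp add: add distrib_right sum.distrib)
    qed (simp add: add int_group_ring_mult_outside)
  qed
qed

lemma semiring_nonneg_group_semiring: "semiring (nonneg_group_semiring G)"
proof -
  let ?R = "int_group_ring G" and ?S = "nonneg_group_semiring G"
  interpret R: ring ?R by (rule ring_int_group_ring)
  have car: "carrier ?S = {f \<in> carrier ?R. \<forall>x. 0 \<le> f x}"
    and ops: "monoid.mult ?S = monoid.mult ?R" "one ?S = one ?R" "zero ?S = zero ?R" "add ?S = add ?R"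
    by (simp_all add: nonneg_group_semiring_def)
  have nonneg: "0 \<le> (f \<otimes>\<^bsub>?R\<^esub> g) x" if "\<forall>x. 0 \<le> f x" "\<forall>x. 0 \<le> g x" for f g x
    using that by (auto simp: int_group_ring_def intro!: sum_nonneg)
  have closed: "f \<oplus>\<^bsub>?R\<^esub> g \<in> carrier ?S" "f \<otimes>\<^bsub>?R\<^esub> g \<in> carrier ?S"
    if "f \<in> carrier ?S" "g \<in> carrier ?S" for f g
  proof -
    have "(f \<oplus>\<^bsub>?R\<^esub> g) x = f x + g x" for x by (simp add: int_group_ring_def)
    with that show "f \<oplus>\<^bsub>?R\<^esub> g \<in> carrier ?S" by (simp add: car)
    from that show "f \<otimes>\<^bsub>?R\<^esub> g \<in> carrier ?S" by (simp add: car nonneg)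
  qed
  have "\<forall>x. 0 \<le> \<zero>\<^bsub>?R\<^esub> x" "\<forall>x. 0 \<le> \<one>\<^bsub>?R\<^esub> x" by (simp_all add: int_group_ring_def)
  then have zero_one: "\<zero>\<^bsub>?R\<^esub> \<in> carrier ?S" "\<one>\<^bsub>?R\<^esub> \<in> carrier ?S" by (simp_all add: car)
  have sub: "f \<in> carrier ?R" if "f \<in> carrier ?S" for f using that by (simp add: car)
  show ?thesis
  proof (intro semiring.intro semiring_axioms.intro)
    show "abelian_monoid ?S"
      by (rule abelian_monoidI; unfold ops)
        (simp_all add: closed zero_one sub R.a_ac)
    show "monoid ?S"
      by (rule monoidI; unfold ops) (simp_all add: closed zero_one sub R.m_assoc)
  qed (simp_all add: ops sub R.l_distr R.r_distr)
qed

end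

end

theory Submission
  imports Defs "HOL-Algebra.Generated_Groups"
begin

text \<open>
  Let \<open>S\<close> be the semiring of non-negative elements of the integral group ring of \<open>G\<close>. As \<open>M\<close> is an
  abelian group, its congruences correspond to the subgroups that are stable under the scalars
  (\<open>elementary_iff_no_stable_subgroup\<close>). Such a subgroup is a subsemimodule, so minimal implies
  elementary.

  The converse needs every subsemimodule to be closed under negation. This holds once some positive
  integer \<open>k\<close> annihilates \<open>M\<close>, for then \<open>-n = (k - 1) n\<close>. To find \<open>k\<close>, let \<open>M\<close> be elementary. Since
  \<open>G\<close> is finite, \<open>S\<close> is finitely generated as an additive monoid, and so \<open>M\<close>, being generated as a
  stable subgroup by any non-zero element, is a finitely generated abelian group
  (\<open>elementary_finitely_generated_additive\<close>). Each subgroup \<open>k M\<close> is stable, hence zero or \<open>M\<close>; and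
  \<open>k M = M\<close> for all positive \<open>k\<close> is impossible because a non-zero finitely generated abelian group is
  not divisible (\<open>divisible_finitely_generated_trivial\<close>).

  Finally, the action of \<open>S\<close> extends to the group ring by \<open>(a - b) m = a m - b m\<close>
  (\<open>int_extension_semiring_module\<close>). Whenever \<open>M\<close> is the restriction of a module \<open>N\<close>, the stable
  subgroups of \<open>M\<close> are the submodules of \<open>N\<close> (\<open>stable_subgroup_restriction_iff\<close>), so \<open>M\<close> is elementary
  iff \<open>N\<close> is minimal; and \<open>N\<close> is simple as soon as it is minimal.
\<close>

section \<open>Divisible finitely generated abelian groups\<close>

lemma (in comm_group) generate_insert_decomp:
  assumes x: "x \<in> carrier G" and X: "X \<subseteq> carrier G" and y: "y \<in> generate G (insert x X)"
  obtains h c where "h \<in> generate G X" "y = h \<otimes> x [^] (c::int)"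
proof -
  have "subgroup (generate G X <#> generate G {x}) G"
    using x X by (intro mult_subgroups generate_is_subgroup) auto
  moreover have "insert x X \<subseteq> generate G X <#> generate G {x}"
  proof
    fix z assume "z \<in> insert x X"
    then consider "z = \<one> \<otimes> x" | "z \<in> X" "z = z \<otimes> \<one>" using x X by auto
    then show "z \<in> generate G X <#> generate G {x}"
      unfolding set_mult_def by cases (blast intro: generate.one generate.incl)+
  qed
  ultimately have "y \<in> generate G X <#> generate G {x}"
    using y generate_subgroup_incl by blast
  then show thesis
    using that x by (auto simp: set_mult_def generate_pow)
qed

text \<open>
  Generators can be discarded one at a time. Let \<open>x\<close> be a generator and \<open>H\<close> the subgroup generated
  by the others, so that every element has the form \<open>h \<otimes> x [^] c\<close> with \<open>h \<in> H\<close>. Taking a square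
  root of \<open>x\<close> shows that \<open>x [^] d \<in> H\<close> for some \<open>d \<noteq> 0\<close>; the coset of \<open>x\<close> thus has finite order
  modulo \<open>H\<close>. Then a \<open>d\<close>-th root of \<open>x\<close> exhibits \<open>x\<close> itself as an element of \<open>H\<close>.
\<close>

lemma (in comm_group) divisible_finitely_generated_trivial:
  assumes fin: "finite X" and X: "X \<subseteq> carrier G" and gen: "generate G X = carrier G"
    and div: "\<And>k x. \<lbrakk> 0 < k; x \<in> carrier G \<rbrakk> \<Longrightarrow> \<exists>y\<in>carrier G. y [^] (k::nat) = x"
  shows "carrier G = {\<one>}"
  using fin X gen
proof (induction X rule: finite_induct)
  case empty
  then show ?case by (simp add: generate_empty)
next
  case (insert x X)
  then have x: "x \<in> carrier G" and X: "X \<subseteq> carrier G" by auto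
  define H where "H = generate G X"
  have H: "subgroup H G" unfolding H_def using X by (rule generate_is_subgroup)
  note Hpow = subgroup_int_pow_closed[OF H]
  note Hin = subgroup.mem_carrier[OF H]
  have decomp: "\<exists>h\<in>H. \<exists>c::int. y = h \<otimes> x [^] c" if "y \<in> carrier G" for y
    using generate_insert_decomp[OF x X, of y] that insert.prems(2) unfolding H_def by metis
  \<comment> \<open>A square root of \<open>x\<close> yields a relation whose exponent is odd, hence non-zero.\<close>
  obtain d :: int where d: "d \<noteq> 0" "x [^] d \<in> H"
  proof -
    obtain y where y: "y \<in> carrier G" "y [^] (2::nat) = x" using div[of 2 x] x by auto
    then obtain h and c :: int where h: "h \<in> H" "y = h \<otimes> x [^] c" using decomp by blast
    have "x = (h \<otimes> x [^] c) [^] (2::int)"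
      using y h by (metis int_pow_int of_nat_numeral)
    also have "\<dots> = h [^] (2::int) \<otimes> x [^] (c * 2)"
      using x h Hin by (simp add: int_pow_distrib int_pow_pow)
    finally have "x [^] (1 - c * 2) = h [^] (2::int)"
      using x h Hin by (metis int_pow_1 int_pow_closed int_pow_diff inv_solve_right')
    then have "x [^] (1 - c * 2) \<in> H" using Hpow h(1) by simp
    moreover have "1 - c * 2 \<noteq> 0" by presburger
    ultimately show thesis using that by blast
  qed
  \<comment> \<open>Raised to the power \<open>\<bar>d\<bar>\<close>, a factor \<open>x [^] c\<close> becomes a power of \<open>x [^] d\<close>, hence an element of \<open>H\<close>.\<close>
  have "x \<in> H"
  proof -
    have "0 < nat \<bar>d\<bar>" using d(1) by simp
    then obtain z where z: "z \<in> carrier G" "z [^] nat \<bar>d\<bar> = x" using div x by blast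
    then obtain h and c :: int where h: "h \<in> H" "z = h \<otimes> x [^] c" using decomp by blast
    have "x = (h \<otimes> x [^] c) [^] \<bar>d\<bar>"
      using z h by (metis abs_ge_zero int_nat_eq int_pow_int)
    also have "\<dots> = h [^] \<bar>d\<bar> \<otimes> (x [^] d) [^] (sgn d * c)"
      using x h Hin by (simp add: int_pow_distrib int_pow_pow abs_sgn ac_simps)
    also have "\<dots> \<in> H"
      using Hpow h(1) d(2) by (intro subgroup.m_closed[OF H]) auto
    finally show ?thesis .
  qed
  then have "insert x X \<subseteq> H" unfolding H_def by (auto intro: generate.incl)
  then have "carrier G \<subseteq> H" using generate_subgroup_incl[OF _ H] insert.prems(2) by metis
  then have "generate G X = carrier G" using subgroup.subset[OF H] unfolding H_def by blast
  then show ?case using insert.IH X by blast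
qed

section \<open>Congruences and stable subgroups\<close>

text \<open>
  Over a ring of scalars every subsemimodule is a subgroup, because \<open>-1\<close> acts as negation. Over a
  semiring this can fail, and the difference between the two notions is exactly what separates
  minimal from elementary.
\<close>

definition stable_subgroup ::
  "'m set \<Rightarrow> ('a, 'r) ring_scheme \<Rightarrow> ('a, 'm, 'x) module_scheme \<Rightarrow> bool" where
  "stable_subgroup H R M \<longleftrightarrow>
     subgroup H (add_monoid M) \<and> (\<forall>r\<in>carrier R. \<forall>h\<in>H. r \<odot>\<^bsub>M\<^esub> h \<in> H)"

lemma subsemimodule_iff:
  "subsemimodule H R M \<longleftrightarrow>
     H \<subseteq> carrier M \<and> \<zero>\<^bsub>M\<^esub> \<in> H \<and> (\<forall>a\<in>H. \<forall>b\<in>H. a \<oplus>\<^bsub>M\<^esub> b \<in> H) \<and>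
     (\<forall>r\<in>carrier R. \<forall>h\<in>H. r \<odot>\<^bsub>M\<^esub> h \<in> H)"
  unfolding subsemimodule_def by (auto simp: submonoid_def)

lemma semimodule_congruenceD:
  assumes "semimodule_congruence R M E"
  shows "m \<in> carrier M \<Longrightarrow> (m, m) \<in> E"
    and "(m, n) \<in> E \<Longrightarrow> (n, m) \<in> E"
    and "(m, n) \<in> E \<Longrightarrow> (n, k) \<in> E \<Longrightarrow> (m, k) \<in> E"
    and "(m, n) \<in> E \<Longrightarrow> m \<in> carrier M \<and> n \<in> carrier M"
    and "(m, n) \<in> E \<Longrightarrow> k \<in> carrier M \<Longrightarrow> (m \<oplus>\<^bsub>M\<^esub> k, n \<oplus>\<^bsub>M\<^esub> k) \<in> E"
    and "(m, n) \<in> E \<Longrightarrow> r \<in> carrier R \<Longrightarrow> (r \<odot>\<^bsub>M\<^esub> m, r \<odot>\<^bsub>M\<^esub> n) \<in> E"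
proof -
  have E: "equiv (carrier M) E" using assms by (simp add: semimodule_congruence_def)
  show "m \<in> carrier M \<Longrightarrow> (m, m) \<in> E" using E by (meson equivE refl_onD)
  show "(m, n) \<in> E \<Longrightarrow> (n, m) \<in> E" using E by (meson equivE symD)
  show "(m, n) \<in> E \<Longrightarrow> (n, k) \<in> E \<Longrightarrow> (m, k) \<in> E" using E by (meson equivE transD)
  show "(m, n) \<in> E \<Longrightarrow> m \<in> carrier M \<and> n \<in> carrier M" using E equiv_type by blast
qed (use assms in \<open>auto simp: semimodule_congruence_def\<close>)

context semiring_module
begin

lemma stable_subgroup_iff:
  "stable_subgroup H R M \<longleftrightarrow> subsemimodule H R M \<and> (\<forall>h\<in>H. \<ominus>\<^bsub>M\<^esub> h \<in> H)"
proof
  assume "stable_subgroup H R M"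
  then show "subsemimodule H R M \<and> (\<forall>h\<in>H. \<ominus>\<^bsub>M\<^esub> h \<in> H)"
    unfolding stable_subgroup_def subsemimodule_iff a_inv_def
    using subgroup.subset[of H "add_monoid M"] subgroup.one_closed[of H "add_monoid M"]
      subgroup.m_closed[of H "add_monoid M"] subgroup.m_inv_closed[of H "add_monoid M"]
    by auto
next
  assume H: "subsemimodule H R M \<and> (\<forall>h\<in>H. \<ominus>\<^bsub>M\<^esub> h \<in> H)"
  then have "subgroup H (add_monoid M)"
    unfolding subsemimodule_iff a_inv_def
    by (intro group.subgroupI[OF a_group]) auto
  with H show "stable_subgroup H R M" by (simp add: stable_subgroup_def subsemimodule_iff)
qed

lemma a_inv_zero: "\<ominus>\<^bsub>M\<^esub> \<zero>\<^bsub>M\<^esub> = \<zero>\<^bsub>M\<^esub>"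
  by (intro minus_equality) simp_all

lemma smult_a_inv:
  assumes "r \<in> carrier R" "m \<in> carrier M"
  shows "r \<odot>\<^bsub>M\<^esub> (\<ominus>\<^bsub>M\<^esub> m) = \<ominus>\<^bsub>M\<^esub> (r \<odot>\<^bsub>M\<^esub> m)"
  using assms smult_r_distr[of r "\<ominus>\<^bsub>M\<^esub> m" m] smult_r_null[of r]
  by (intro minus_equality[symmetric]) (simp_all add: l_neg)

lemma smult_minus:
  assumes "r \<in> carrier R" "m \<in> carrier M" "n \<in> carrier M"
  shows "r \<odot>\<^bsub>M\<^esub> (m \<ominus>\<^bsub>M\<^esub> n) = r \<odot>\<^bsub>M\<^esub> m \<ominus>\<^bsub>M\<^esub> r \<odot>\<^bsub>M\<^esub> n"
  using assms by (simp add: a_minus_def smult_r_distr smult_a_inv)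

lemma smult_nat_pow:
  assumes "r \<in> carrier R" "m \<in> carrier M"
  shows "r \<odot>\<^bsub>M\<^esub> ([(k::nat)] \<cdot>\<^bsub>M\<^esub> m) = [k] \<cdot>\<^bsub>M\<^esub> (r \<odot>\<^bsub>M\<^esub> m)"
  using assms by (induction k) (simp_all add: smult_r_null smult_r_distr)

lemma diff_add_diff:
  assumes "a \<in> carrier M" "b \<in> carrier M" "c \<in> carrier M" "d \<in> carrier M"
  shows "(a \<ominus>\<^bsub>M\<^esub> b) \<oplus>\<^bsub>M\<^esub> (c \<ominus>\<^bsub>M\<^esub> d) = (a \<oplus>\<^bsub>M\<^esub> c) \<ominus>\<^bsub>M\<^esub> (b \<oplus>\<^bsub>M\<^esub> d)"
  using assms by (simp add: a_minus_def minus_add M.a_ac)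

lemma diff_eq_iff:
  assumes "a \<in> carrier M" "b \<in> carrier M" "c \<in> carrier M" "d \<in> carrier M"
  shows "a \<ominus>\<^bsub>M\<^esub> b = c \<ominus>\<^bsub>M\<^esub> d \<longleftrightarrow> a \<oplus>\<^bsub>M\<^esub> d = c \<oplus>\<^bsub>M\<^esub> b"
proof -
  have "a \<ominus>\<^bsub>M\<^esub> b = c \<ominus>\<^bsub>M\<^esub> d \<longleftrightarrow>
      (a \<ominus>\<^bsub>M\<^esub> b) \<oplus>\<^bsub>M\<^esub> (b \<oplus>\<^bsub>M\<^esub> d) = (c \<ominus>\<^bsub>M\<^esub> d) \<oplus>\<^bsub>M\<^esub> (b \<oplus>\<^bsub>M\<^esub> d)"
    using assms by simp
  moreover have "(a \<ominus>\<^bsub>M\<^esub> b) \<oplus>\<^bsub>M\<^esub> (b \<oplus>\<^bsub>M\<^esub> d) = a \<oplus>\<^bsub>M\<^esub> d"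
    using assms by (simp add: a_minus_def M.a_assoc r_neg1)
  moreover have "(c \<ominus>\<^bsub>M\<^esub> d) \<oplus>\<^bsub>M\<^esub> (b \<oplus>\<^bsub>M\<^esub> d) = c \<oplus>\<^bsub>M\<^esub> b"
    using assms by (simp add: a_minus_def M.a_assoc r_neg1 M.a_comm[of b d])
  ultimately show ?thesis by simp
qed

lemma congruence_of_stable_subgroup:
  assumes H: "stable_subgroup H R M"
  shows "semimodule_congruence R M
    {(m, n). m \<in> carrier M \<and> n \<in> carrier M \<and> m \<ominus>\<^bsub>M\<^esub> n \<in> H}"
    (is "semimodule_congruence R M ?E")
proof -
  have H': "\<zero>\<^bsub>M\<^esub> \<in> H" "\<And>a b. a \<in> H \<Longrightarrow> b \<in> H \<Longrightarrow> a \<oplus>\<^bsub>M\<^esub> b \<in> H"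
    "\<And>h. h \<in> H \<Longrightarrow> \<ominus>\<^bsub>M\<^esub> h \<in> H" "\<And>r h. r \<in> carrier R \<Longrightarrow> h \<in> H \<Longrightarrow> r \<odot>\<^bsub>M\<^esub> h \<in> H"
    using H unfolding stable_subgroup_iff subsemimodule_iff by auto
  have eq: "equiv (carrier M) ?E"
  proof (rule equivI)
    show "refl_on (carrier M) ?E"
      using H'(1) by (auto simp: refl_on_def a_minus_def r_neg)
    show "sym ?E"
    proof (rule symI)
      fix m n assume mn: "(m, n) \<in> ?E"
      then have "n \<ominus>\<^bsub>M\<^esub> m = \<ominus>\<^bsub>M\<^esub> (m \<ominus>\<^bsub>M\<^esub> n)"
        by (simp add: a_minus_def minus_add M.a_comm)
      with mn H'(3) show "(n, m) \<in> ?E" by simp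
    qed
    show "trans ?E"
    proof (rule transI)
      fix m n k assume *: "(m, n) \<in> ?E" "(n, k) \<in> ?E"
      then have "m \<ominus>\<^bsub>M\<^esub> k = (m \<ominus>\<^bsub>M\<^esub> n) \<oplus>\<^bsub>M\<^esub> (n \<ominus>\<^bsub>M\<^esub> k)"
        by (simp add: diff_add_diff diff_eq_iff M.a_ac)
      with * H'(2) show "(m, k) \<in> ?E" by simp
    qed
  qed auto
  have add: "(m \<oplus>\<^bsub>M\<^esub> k, n \<oplus>\<^bsub>M\<^esub> k) \<in> ?E" if "(m, n) \<in> ?E" "k \<in> carrier M" for m n k
  proof -
    have "(m \<oplus>\<^bsub>M\<^esub> k) \<ominus>\<^bsub>M\<^esub> (n \<oplus>\<^bsub>M\<^esub> k) = m \<ominus>\<^bsub>M\<^esub> n"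
      using that by (simp add: diff_eq_iff M.a_ac)
    with that show ?thesis by simp
  qed
  have smult: "(r \<odot>\<^bsub>M\<^esub> m, r \<odot>\<^bsub>M\<^esub> n) \<in> ?E" if "(m, n) \<in> ?E" "r \<in> carrier R" for m n r
    using that H'(4)[of r "m \<ominus>\<^bsub>M\<^esub> n"] by (simp add: smult_minus)
  show ?thesis
    unfolding semimodule_congruence_def
    by (intro conjI allI impI ballI) (erule (1) eq add smult | rule eq)+
qed

lemma stable_subgroup_of_congruence:
  assumes E: "semimodule_congruence R M E"
  shows "stable_subgroup {m. (m, \<zero>\<^bsub>M\<^esub>) \<in> E} R M" (is "stable_subgroup ?H R M")
proof -
  note refl = semimodule_congruenceD(1)[OF E] and sym = semimodule_congruenceD(2)[OF E]
    and trans = semimodule_congruenceD(3)[OF E] and car = semimodule_congruenceD(4)[OF E]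
    and add = semimodule_congruenceD(5)[OF E] and smult = semimodule_congruenceD(6)[OF E]
  show ?thesis
    unfolding stable_subgroup_iff subsemimodule_iff
  proof (intro conjI ballI)
    show "?H \<subseteq> carrier M" using car by blast
    show "\<zero>\<^bsub>M\<^esub> \<in> ?H" using refl by simp
    fix a assume a: "a \<in> ?H"
    then have aM: "a \<in> carrier M" using car by blast
    { fix b assume b: "b \<in> ?H"
      then have "b \<in> carrier M" using car by blast
      with add[of a "\<zero>\<^bsub>M\<^esub>" b] a b trans show "a \<oplus>\<^bsub>M\<^esub> b \<in> ?H" by auto }
    show "\<ominus>\<^bsub>M\<^esub> a \<in> ?H"
      using add[of a "\<zero>\<^bsub>M\<^esub>" "\<ominus>\<^bsub>M\<^esub> a"] a aM sym by (simp add: r_neg)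
    show "r \<odot>\<^bsub>M\<^esub> a \<in> ?H" if "r \<in> carrier R" for r
      using smult[of a "\<zero>\<^bsub>M\<^esub>" r] a that by (simp add: smult_r_null)
  qed
qed

text \<open>
  Since \<open>M\<close> has negatives, a congruence is determined by the class of zero, as for quotients of
  modules: \<open>m \<sim> n\<close> holds iff \<open>m - n \<sim> 0\<close>. Equality corresponds to the zero subgroup and the full
  relation to all of \<open>M\<close>.
\<close>

lemma elementary_iff_no_stable_subgroup:
  "elementary_semimodule R M \<longleftrightarrow> carrier M \<noteq> {\<zero>\<^bsub>M\<^esub>} \<and>
     (\<forall>H. stable_subgroup H R M \<longrightarrow> H = {\<zero>\<^bsub>M\<^esub>} \<or> H = carrier M)"
proof (intro iffI conjI allI impI)
  assume el: "elementary_semimodule R M"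
  then show "carrier M \<noteq> {\<zero>\<^bsub>M\<^esub>}" by (simp add: elementary_semimodule_def)
  fix H assume H: "stable_subgroup H R M"
  let ?E = "{(m, n). m \<in> carrier M \<and> n \<in> carrier M \<and> m \<ominus>\<^bsub>M\<^esub> n \<in> H}"
  have sub: "H \<subseteq> carrier M" "\<zero>\<^bsub>M\<^esub> \<in> H"
    using H unfolding stable_subgroup_iff subsemimodule_iff by auto
  have E: "(m, \<zero>\<^bsub>M\<^esub>) \<in> ?E \<longleftrightarrow> m \<in> H" if "m \<in> carrier M" for m
    using that by (simp add: a_minus_def a_inv_zero)
  have "?E = Id_on (carrier M) \<or> ?E = carrier M \<times> carrier M"
    using el congruence_of_stable_subgroup[OF H] unfolding elementary_semimodule_def by blast
  then show "H = {\<zero>\<^bsub>M\<^esub>} \<or> H = carrier M"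
  proof
    assume Id: "?E = Id_on (carrier M)"
    have "h = \<zero>\<^bsub>M\<^esub>" if "h \<in> H" for h
    proof -
      have "(h, \<zero>\<^bsub>M\<^esub>) \<in> ?E" using E that sub by blast
      then show ?thesis unfolding Id by auto
    qed
    with sub show ?thesis by blast
  next
    assume "?E = carrier M \<times> carrier M"
    then have "(m, \<zero>\<^bsub>M\<^esub>) \<in> ?E" if "m \<in> carrier M" for m using that by simp
    then have "carrier M \<subseteq> H" using E by blast
    with sub show ?thesis by blast
  qed
next
  assume *: "carrier M \<noteq> {\<zero>\<^bsub>M\<^esub>} \<and>
     (\<forall>H. stable_subgroup H R M \<longrightarrow> H = {\<zero>\<^bsub>M\<^esub>} \<or> H = carrier M)"
  have "E = Id_on (carrier M) \<or> E = carrier M \<times> carrier M" if E: "semimodule_congruence R M E" for E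
  proof -
    note refl = semimodule_congruenceD(1)[OF E] and sym = semimodule_congruenceD(2)[OF E]
      and trans = semimodule_congruenceD(3)[OF E] and car = semimodule_congruenceD(4)[OF E]
      and add = semimodule_congruenceD(5)[OF E]
    have "{m. (m, \<zero>\<^bsub>M\<^esub>) \<in> E} = {\<zero>\<^bsub>M\<^esub>} \<or> {m. (m, \<zero>\<^bsub>M\<^esub>) \<in> E} = carrier M"
      using * stable_subgroup_of_congruence[OF E] by blast
    then show ?thesis
    proof
      assume triv: "{m. (m, \<zero>\<^bsub>M\<^esub>) \<in> E} = {\<zero>\<^bsub>M\<^esub>}"
      have "m = n" if mn: "(m, n) \<in> E" for m n
      proof -
        have mn': "m \<in> carrier M" "n \<in> carrier M" using car[OF mn] by auto
        then have "(m \<ominus>\<^bsub>M\<^esub> n, \<zero>\<^bsub>M\<^esub>) \<in> E"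
          using add[OF mn, of "\<ominus>\<^bsub>M\<^esub> n"] by (simp add: a_minus_def r_neg)
        then have "m \<ominus>\<^bsub>M\<^esub> n = n \<ominus>\<^bsub>M\<^esub> n" using triv mn' by (auto simp: a_minus_def r_neg)
        with mn' show ?thesis by (simp add: diff_eq_iff)
      qed
      then have "(m, n) \<in> E \<longleftrightarrow> (m, n) \<in> Id_on (carrier M)" for m n
        unfolding Id_on_iff using refl car by metis
      then have "E = Id_on (carrier M)" by (simp only: set_eq_iff split_paired_All simp_thms)
      then show ?thesis ..
    next
      assume "{m. (m, \<zero>\<^bsub>M\<^esub>) \<in> E} = carrier M"
      then have "(m, \<zero>\<^bsub>M\<^esub>) \<in> E" if "m \<in> carrier M" for m using that by blast
      then have "(m, n) \<in> E" if "m \<in> carrier M" "n \<in> carrier M" for m n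
        using trans[of m "\<zero>\<^bsub>M\<^esub>" n] sym[of n "\<zero>\<^bsub>M\<^esub>"] that by simp
      then have "carrier M \<times> carrier M \<subseteq> E" by (intro subrelI) simp
      moreover have "E \<subseteq> carrier M \<times> carrier M" by (intro subrelI) (drule car, simp)
      ultimately have "E = carrier M \<times> carrier M" by (intro equalityI)
      then show ?thesis ..
    qed
  qed
  with * show "elementary_semimodule R M"
    unfolding elementary_semimodule_def using semimodule_axioms by blast
qed

lemma minimal_imp_elementary:
  assumes "minimal_semimodule R M"
  shows "elementary_semimodule R M"
  using assms unfolding elementary_iff_no_stable_subgroup minimal_semimodule_def
    stable_subgroup_iff by blast

section \<open>Elementary modules over additively finitely generated semirings\<close>

text \<open>
  Here \<open>X\<close> generates the scalars as an additive monoid. For a non-zero \<open>m\<close>, the differences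
  \<open>r m - s m\<close> form the stable subgroup generated by \<open>m\<close>, which is everything if \<open>M\<close> is elementary;
  and each \<open>r m\<close> is a sum of elements \<open>x m\<close> with \<open>x \<in> X\<close>.
\<close>

lemma elementary_finitely_generated_additive:
  assumes el: "elementary_semimodule R M"
    and X: "finite X" "X \<subseteq> carrier R"
    and gen: "\<And>T. \<lbrakk> submonoid T (add_monoid R); X \<subseteq> T \<rbrakk> \<Longrightarrow> carrier R \<subseteq> T"
  obtains Y where "finite Y" "Y \<subseteq> carrier M" "generate (add_monoid M) Y = carrier M"
proof -
  obtain m where m: "m \<in> carrier M" "m \<noteq> \<zero>\<^bsub>M\<^esub>"
    using el unfolding elementary_semimodule_def by auto
  define Y where "Y = (\<lambda>r. r \<odot>\<^bsub>M\<^esub> m) ` X"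
  have Y: "finite Y" "Y \<subseteq> carrier M" using X m by (auto simp: Y_def)
  let ?A = "generate (add_monoid M) Y"
  have A: "subgroup ?A (add_monoid M)" using Y by (intro group.generate_is_subgroup[OF a_group]) simp
  have "submonoid {r \<in> carrier R. r \<odot>\<^bsub>M\<^esub> m \<in> ?A} (add_monoid R)"
    using m A subgroup.one_closed[OF A] subgroup.m_closed[OF A]
    by (auto simp: submonoid_def smult_l_null smult_l_distr)
  moreover have "X \<subseteq> {r \<in> carrier R. r \<odot>\<^bsub>M\<^esub> m \<in> ?A}"
    using X by (auto simp: Y_def intro: generate.incl)
  ultimately have orbit: "r \<odot>\<^bsub>M\<^esub> m \<in> ?A" if "r \<in> carrier R" for r
    using gen that by blast
  define K where "K = {r \<odot>\<^bsub>M\<^esub> m \<ominus>\<^bsub>M\<^esub> s \<odot>\<^bsub>M\<^esub> m | r s. r \<in> carrier R \<and> s \<in> carrier R}"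
  have KI: "k \<in> K" if "k = r \<odot>\<^bsub>M\<^esub> m \<ominus>\<^bsub>M\<^esub> s \<odot>\<^bsub>M\<^esub> m" "r \<in> carrier R" "s \<in> carrier R" for k r s
    using that unfolding K_def by blast
  have KE: "\<exists>r\<in>carrier R. \<exists>s\<in>carrier R. k = r \<odot>\<^bsub>M\<^esub> m \<ominus>\<^bsub>M\<^esub> s \<odot>\<^bsub>M\<^esub> m" if "k \<in> K" for k
    using that unfolding K_def by blast
  have "stable_subgroup K R M"
    unfolding stable_subgroup_iff subsemimodule_iff
  proof (intro conjI ballI)
    show "K \<subseteq> carrier M" using m by (auto simp: K_def)
    show "\<zero>\<^bsub>M\<^esub> \<in> K" using m by (intro KI[of _ "\<zero>" "\<zero>"]) (simp_all add: a_minus_def r_neg smult_l_null)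
    fix a assume "a \<in> K"
    then obtain r s where a: "a = r \<odot>\<^bsub>M\<^esub> m \<ominus>\<^bsub>M\<^esub> s \<odot>\<^bsub>M\<^esub> m" "r \<in> carrier R" "s \<in> carrier R"
      using KE by blast
    { fix b assume "b \<in> K"
      then obtain r' s' where b: "b = r' \<odot>\<^bsub>M\<^esub> m \<ominus>\<^bsub>M\<^esub> s' \<odot>\<^bsub>M\<^esub> m" "r' \<in> carrier R" "s' \<in> carrier R"
        using KE by blast
      show "a \<oplus>\<^bsub>M\<^esub> b \<in> K"
        using a b m by (intro KI[of _ "r \<oplus> r'" "s \<oplus> s'"]) (simp_all add: smult_l_distr diff_add_diff) }
    show "\<ominus>\<^bsub>M\<^esub> a \<in> K"
      using a m by (intro KI[of _ s r]) (simp_all add: a_minus_def minus_add M.a_comm)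
    show "t \<odot>\<^bsub>M\<^esub> a \<in> K" if "t \<in> carrier R" for t
      using a m that by (intro KI[of _ "t \<otimes> r" "t \<otimes> s"]) (simp_all add: smult_minus smult_assoc)
  qed
  moreover have "m \<in> K"
    using m by (intro KI[of _ "\<one>" "\<zero>"]) (simp_all add: smult_one smult_l_null a_minus_def)
  ultimately have "K = carrier M"
    using el m unfolding elementary_iff_no_stable_subgroup by blast
  moreover have "K \<subseteq> ?A"
    using orbit subgroup.m_closed[OF A] subgroup.m_inv_closed[OF A]
    by (auto simp: K_def a_minus_def a_inv_def)
  moreover have "?A \<subseteq> carrier M" using subgroup.subset[OF A] by simp
  ultimately have "?A = carrier M" by simp
  with that Y show thesis by simp
qed

text \<open>
  Each \<open>k M\<close> is a stable subgroup, hence zero or \<open>M\<close>. If it were \<open>M\<close> for every positive \<open>k\<close>, then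
  \<open>M\<close> would be a divisible finitely generated group and therefore zero.
\<close>

lemma elementary_imp_bounded_exponent:
  assumes el: "elementary_semimodule R M"
    and Y: "finite Y" "Y \<subseteq> carrier M" "generate (add_monoid M) Y = carrier M"
  obtains k :: nat where "0 < k" "\<And>m. m \<in> carrier M \<Longrightarrow> [k] \<cdot>\<^bsub>M\<^esub> m = \<zero>\<^bsub>M\<^esub>"
proof -
  note bounded = that
  let ?mult = "\<lambda>k::nat. (\<lambda>m. [k] \<cdot>\<^bsub>M\<^esub> m) ` carrier M"
  have stable: "stable_subgroup (?mult k) R M" for k
    unfolding stable_subgroup_iff subsemimodule_iff
  proof (intro conjI ballI)
    show "\<zero>\<^bsub>M\<^esub> \<in> ?mult k" by (rule image_eqI[of _ _ "\<zero>\<^bsub>M\<^esub>"]) simp_all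
    fix a assume "a \<in> ?mult k"
    then obtain m where a: "m \<in> carrier M" "a = [k] \<cdot>\<^bsub>M\<^esub> m" by blast
    { fix b assume "b \<in> ?mult k"
      then obtain n where b: "n \<in> carrier M" "b = [k] \<cdot>\<^bsub>M\<^esub> n" by blast
      with a have "a \<oplus>\<^bsub>M\<^esub> b = [k] \<cdot>\<^bsub>M\<^esub> (m \<oplus>\<^bsub>M\<^esub> n)"
        by (simp add: M.add.nat_pow_distrib)
      with a b show "a \<oplus>\<^bsub>M\<^esub> b \<in> ?mult k" by blast }
    have "\<ominus>\<^bsub>M\<^esub> a = [k] \<cdot>\<^bsub>M\<^esub> (\<ominus>\<^bsub>M\<^esub> m)" using a by (simp add: add.nat_pow_inv)
    with a show "\<ominus>\<^bsub>M\<^esub> a \<in> ?mult k" by blast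
    show "r \<odot>\<^bsub>M\<^esub> a \<in> ?mult k" if "r \<in> carrier R" for r
      using a that by (auto simp: smult_nat_pow)
  qed auto
  show thesis
  proof (rule ccontr)
    assume contr: "\<not> thesis"
    have div: "\<exists>n\<in>carrier M. [k] \<cdot>\<^bsub>M\<^esub> n = m" if "0 < k" "m \<in> carrier M" for k :: nat and m
    proof -
      have "?mult k \<noteq> {\<zero>\<^bsub>M\<^esub>}"
      proof
        assume *: "?mult k = {\<zero>\<^bsub>M\<^esub>}"
        have "[k] \<cdot>\<^bsub>M\<^esub> n = \<zero>\<^bsub>M\<^esub>" if "n \<in> carrier M" for n
          using * imageI[OF that, of "\<lambda>n. [k] \<cdot>\<^bsub>M\<^esub> n"] by simp
        then show False using bounded[OF that(1)] contr by simp
      qed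
      then have "?mult k = carrier M"
        using el stable[of k] unfolding elementary_iff_no_stable_subgroup by blast
      then show ?thesis using that(2) by (metis imageE)
    qed
    have "carrier (add_monoid M) = {\<one>\<^bsub>add_monoid M\<^esub>}"
      by (rule comm_group.divisible_finitely_generated_trivial[OF a_comm_group Y(1)])
        (use Y div in \<open>simp_all flip: add_pow_def\<close>)
    then show False using el by (simp add: elementary_semimodule_def)
  qed
qed

text \<open>
  In exponent \<open>k\<close> the negative of \<open>n\<close> is the multiple \<open>(k - 1) n\<close>, so a submonoid is
  closed under negation, and every subsemimodule is a stable subgroup.
\<close>

lemma bounded_exponent_elementary_imp_minimal:
  assumes el: "elementary_semimodule R M"
    and k: "0 < k" "\<And>m. m \<in> carrier M \<Longrightarrow> [(k::nat)] \<cdot>\<^bsub>M\<^esub> m = \<zero>\<^bsub>M\<^esub>"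
  shows "minimal_semimodule R M"
proof -
  have "stable_subgroup N R M" if N: "subsemimodule N R M" for N
  proof -
    have "\<ominus>\<^bsub>M\<^esub> n \<in> N" if n: "n \<in> N" for n
    proof -
      have nM: "n \<in> carrier M" using N n by (auto simp: subsemimodule_iff)
      have "[j] \<cdot>\<^bsub>M\<^esub> n \<in> N" for j :: nat
        using N n by (induction j) (auto simp: subsemimodule_iff)
      moreover have "\<ominus>\<^bsub>M\<^esub> n = [(k - 1)] \<cdot>\<^bsub>M\<^esub> n"
        using k nM by (intro minus_equality) (auto simp flip: M.add.nat_pow_Suc)
      ultimately show ?thesis by simp
    qed
    with N show ?thesis by (simp add: stable_subgroup_iff)
  qed
  with el show ?thesis
    unfolding elementary_iff_no_stable_subgroup minimal_semimodule_def
    using semimodule_axioms by blast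
qed

end

section \<open>Non-negative elements of the group ring\<close>

lemma nonneg_group_semiring_simps:
  "monoid.mult (nonneg_group_semiring G) = monoid.mult (int_group_ring G)"
  "one (nonneg_group_semiring G) = one (int_group_ring G)"
  "zero (nonneg_group_semiring G) = zero (int_group_ring G)"
  "add (nonneg_group_semiring G) = add (int_group_ring G)"
  by (simp_all add: nonneg_group_semiring_def)

lemma nonneg_subset: "f \<in> carrier (nonneg_group_semiring G) \<Longrightarrow> f \<in> carrier (int_group_ring G)"
  by (simp add: nonneg_group_semiring_def)

text \<open>
  Every element of the integral group ring is the difference of its positive and negative parts. So
  the group ring is the ring of differences of its non-negative elements, which lets scalar actions,
  and stability under them, pass from the semiring to the ring.
\<close>

definition pos_part :: "('g \<Rightarrow> int) \<Rightarrow> 'g \<Rightarrow> int" where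
  "pos_part f = (\<lambda>x. max (f x) 0)"

definition neg_part :: "('g \<Rightarrow> int) \<Rightarrow> 'g \<Rightarrow> int" where
  "neg_part f = (\<lambda>x. max (- f x) 0)"

lemma pos_neg_part_closed:
  assumes "f \<in> carrier (int_group_ring G)"
  shows "pos_part f \<in> carrier (nonneg_group_semiring G)"
    and "neg_part f \<in> carrier (nonneg_group_semiring G)"
proof -
  have "{x. pos_part f x \<noteq> 0} \<subseteq> {x. f x \<noteq> 0}" "{x. neg_part f x \<noteq> 0} \<subseteq> {x. f x \<noteq> 0}"
    by (auto simp: pos_part_def neg_part_def)
  with assms show "pos_part f \<in> carrier (nonneg_group_semiring G)"
    "neg_part f \<in> carrier (nonneg_group_semiring G)"
    unfolding nonneg_group_semiring_def int_group_ring_def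
    by (auto intro: finite_subset simp: pos_part_def neg_part_def)
qed

lemma add_neg_part: "f \<oplus>\<^bsub>int_group_ring G\<^esub> neg_part f = pos_part f"
  by (auto simp: int_group_ring_def pos_part_def neg_part_def)

text \<open>
  The group elements generate the semiring additively, by induction on the sum of the coefficients:
  a non-zero function has a positive coefficient, which can be lowered by one.
\<close>

lemma nonneg_group_semiring_generated:
  assumes fin: "finite (carrier G)"
    and T: "submonoid T (add_monoid (nonneg_group_semiring G))"
    and basis: "(\<lambda>g x. if x = g then 1 else 0) ` carrier G \<subseteq> T"
  shows "carrier (nonneg_group_semiring G) \<subseteq> T"
proof
  have zero: "(\<lambda>x. 0) \<in> T"
    using submonoid.one_closed[OF T] by (simp add: nonneg_group_semiring_def int_group_ring_def)
  have add: "(\<lambda>x. a x + b x) \<in> T" if "a \<in> T" "b \<in> T" for a b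
    using submonoid.m_closed[OF T that] by (simp add: nonneg_group_semiring_def int_group_ring_def)
  fix f assume "f \<in> carrier (nonneg_group_semiring G)"
  then have "\<forall>x. 0 \<le> f x" "{x. f x \<noteq> 0} \<subseteq> carrier G"
    by (auto simp: nonneg_group_semiring_def int_group_ring_def)
  then show "f \<in> T"
  proof (induction "nat (\<Sum>x\<in>carrier G. f x)" arbitrary: f rule: less_induct)
    case less
    show ?case
    proof (cases "\<exists>g. f g \<noteq> 0")
      case False
      then have "f = (\<lambda>x. 0)" by auto
      with zero show ?thesis by simp
    next
      case True
      then obtain g where g: "f g \<noteq> 0" by blast
      then have gG: "g \<in> carrier G" using less.prems by blast
      have pos: "1 \<le> f g" using less.prems(1) g by (metis int_one_le_iff_zero_less order_le_less)
      let ?f = "\<lambda>x. f x - (if x = g then 1 else 0)"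
      have "(\<Sum>x\<in>carrier G. ?f x) = (\<Sum>x\<in>carrier G. f x) - 1"
        using fin gG by (simp add: sum_subtractf)
      moreover have "f g \<le> (\<Sum>x\<in>carrier G. f x)"
        using fin gG less.prems(1) by (intro member_le_sum) auto
      ultimately have "nat (\<Sum>x\<in>carrier G. ?f x) < nat (\<Sum>x\<in>carrier G. f x)" using pos by simp
      then have "?f \<in> T"
        by (rule less.hyps) (use less.prems pos gG in auto)
      moreover have "(\<lambda>x. if x = g then 1 else 0) \<in> T" using basis gG by blast
      ultimately have "(\<lambda>x. ?f x + (if x = g then 1 else 0)) \<in> T" by (rule add)
      then show ?thesis by simp
    qed
  qed
qed

section \<open>Extending the scalars to the integral group ring\<close>

text \<open>
  A semimodule that is a group admits exactly one extension of its scalar action to formal differences,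
  namely \<open>(a - b) m = a m - b m\<close>.
\<close>

definition int_extension ::
  "('g \<Rightarrow> int, 'm, 'x) module_scheme \<Rightarrow> ('g \<Rightarrow> int, 'm, 'x) module_scheme" where
  "int_extension M = M \<lparr>smult := \<lambda>f m. pos_part f \<odot>\<^bsub>M\<^esub> m \<ominus>\<^bsub>M\<^esub> neg_part f \<odot>\<^bsub>M\<^esub> m\<rparr>"

lemma int_extension_simps:
  "carrier (int_extension M) = carrier M" "zero (int_extension M) = zero M"
  "add (int_extension M) = add M"
  "f \<odot>\<^bsub>int_extension M\<^esub> m = pos_part f \<odot>\<^bsub>M\<^esub> m \<ominus>\<^bsub>M\<^esub> neg_part f \<odot>\<^bsub>M\<^esub> m"
  by (simp_all add: int_extension_def)

text \<open>
  The extended action may be computed from any representation \<open>f = a - b\<close> with non-negative \<open>a\<close> and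
  \<open>b\<close>. Positive and negative parts are compatible neither with sums nor with products, so this
  freedom is what makes the module laws provable.
\<close>

lemma (in group) int_extension_smult_diff:
  assumes M: "semiring_module (nonneg_group_semiring G) M"
    and ab: "a \<in> carrier (nonneg_group_semiring G)" "b \<in> carrier (nonneg_group_semiring G)"
    and f: "f \<in> carrier (int_group_ring G)" "f \<oplus>\<^bsub>int_group_ring G\<^esub> b = a"
    and m: "m \<in> carrier M"
  shows "f \<odot>\<^bsub>int_extension M\<^esub> m = a \<odot>\<^bsub>M\<^esub> m \<ominus>\<^bsub>M\<^esub> b \<odot>\<^bsub>M\<^esub> m"
proof -
  interpret M: semiring_module "nonneg_group_semiring G" M by (rule M)
  interpret Z: ring "int_group_ring G" by (rule ring_int_group_ring)
  note pn = pos_neg_part_closed[OF f(1)]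
  have "pos_part f \<oplus>\<^bsub>nonneg_group_semiring G\<^esub> b = a \<oplus>\<^bsub>nonneg_group_semiring G\<^esub> neg_part f"
    unfolding nonneg_group_semiring_simps add_neg_part[of G f, symmetric] f(2)[symmetric]
    using f(1) ab pn by (simp add: Z.a_ac nonneg_subset)
  then have "pos_part f \<odot>\<^bsub>M\<^esub> m \<oplus>\<^bsub>M\<^esub> b \<odot>\<^bsub>M\<^esub> m = a \<odot>\<^bsub>M\<^esub> m \<oplus>\<^bsub>M\<^esub> neg_part f \<odot>\<^bsub>M\<^esub> m"
    using ab pn m by (simp flip: M.smult_l_distr)
  then show ?thesis
    using ab pn m by (simp add: int_extension_simps M.diff_eq_iff)
qed

lemma (in group) int_extension_smult_nonneg:
  assumes M: "semiring_module (nonneg_group_semiring G) M"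
    and s: "s \<in> carrier (nonneg_group_semiring G)" and m: "m \<in> carrier M"
  shows "s \<odot>\<^bsub>int_extension M\<^esub> m = s \<odot>\<^bsub>M\<^esub> m"
proof -
  interpret M: semiring_module "nonneg_group_semiring G" M by (rule M)
  interpret Z: ring "int_group_ring G" by (rule ring_int_group_ring)
  have "s \<odot>\<^bsub>int_extension M\<^esub> m =
      s \<odot>\<^bsub>M\<^esub> m \<ominus>\<^bsub>M\<^esub> \<zero>\<^bsub>nonneg_group_semiring G\<^esub> \<odot>\<^bsub>M\<^esub> m"
    using s m nonneg_subset[OF s] by (intro int_extension_smult_diff[OF M])
      (simp_all, simp add: nonneg_group_semiring_simps)
  then show ?thesis using s m by (simp add: M.smult_l_null a_minus_def M.a_inv_zero)
qed

text \<open>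
  Writing \<open>r = a - b\<close> and \<open>s = c - d\<close>, the law for products comes from
  \<open>r s = (a c + b d) - (a d + b c)\<close>, and the law for sums from \<open>r + s = (a + c) - (b + d)\<close>.
\<close>

lemma (in group) int_extension_semiring_module:
  assumes M: "semiring_module (nonneg_group_semiring G) M"
  shows "semiring_module (int_group_ring G) (int_extension M)"
proof -
  let ?S = "nonneg_group_semiring G" and ?Z = "int_group_ring G" and ?N = "int_extension M"
  interpret M: semiring_module ?S M by (rule M)
  interpret Z: ring ?Z by (rule ring_int_group_ring)
  note S = nonneg_group_semiring_simps[of G, symmetric]
  note diff = int_extension_smult_diff[OF M]
  note pn = pos_neg_part_closed[of _ G]
  have group_N: "abelian_group ?N"
    using M.a_comm_group by (intro comm_group_abelian_groupI) (simp add: int_extension_simps int_extension_def)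
  have closed: "f \<odot>\<^bsub>?N\<^esub> m \<in> carrier M" if "f \<in> carrier ?Z" "m \<in> carrier M" for f m
    using that pn by (simp add: int_extension_simps)
  show ?thesis
  proof (intro semiring_module.intro semimodule.intro semimodule_axioms.intro)
    show "semiring ?Z" by (rule Z.semiring_axioms)
    show "abelian_monoid ?N" "abelian_group ?N"
      using group_N by (simp_all add: abelian_group.axioms)
  next
    fix r m n assume *: "r \<in> carrier ?Z" "m \<in> carrier ?N" "n \<in> carrier ?N"
    show "r \<odot>\<^bsub>?N\<^esub> m \<in> carrier ?N" using * closed by (simp add: int_extension_simps(1))
    show "r \<odot>\<^bsub>?N\<^esub> (m \<oplus>\<^bsub>?N\<^esub> n) = r \<odot>\<^bsub>?N\<^esub> m \<oplus>\<^bsub>?N\<^esub> r \<odot>\<^bsub>?N\<^esub> n"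
      using * pn by (simp add: int_extension_simps M.smult_r_distr M.diff_add_diff)
  next
    fix r assume "r \<in> carrier ?Z"
    then show "r \<odot>\<^bsub>?N\<^esub> \<zero>\<^bsub>?N\<^esub> = \<zero>\<^bsub>?N\<^esub>"
      using pn by (simp add: int_extension_simps M.smult_r_null a_minus_def M.r_neg)
  next
    fix r s m assume *: "r \<in> carrier ?Z" "s \<in> carrier ?Z" "m \<in> carrier ?N"
    obtain a b where ab: "a \<in> carrier ?S" "b \<in> carrier ?S" "r \<oplus>\<^bsub>?Z\<^esub> b = a"
      using pn[OF *(1)] add_neg_part by blast
    obtain c d where cd: "c \<in> carrier ?S" "d \<in> carrier ?S" "s \<oplus>\<^bsub>?Z\<^esub> d = c"
      using pn[OF *(2)] add_neg_part by blast
    have Zcar: "a \<in> carrier ?Z" "b \<in> carrier ?Z" "c \<in> carrier ?Z" "d \<in> carrier ?Z"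
      using ab cd nonneg_subset by blast+
    have m: "m \<in> carrier M" using * by (simp add: int_extension_simps)
    have r: "r \<odot>\<^bsub>?N\<^esub> n = a \<odot>\<^bsub>M\<^esub> n \<ominus>\<^bsub>M\<^esub> b \<odot>\<^bsub>M\<^esub> n" if "n \<in> carrier M" for n
      using that ab * by (intro diff)
    have s: "s \<odot>\<^bsub>?N\<^esub> m = c \<odot>\<^bsub>M\<^esub> m \<ominus>\<^bsub>M\<^esub> d \<odot>\<^bsub>M\<^esub> m"
      using m cd * by (intro diff)
    have "(r \<oplus>\<^bsub>?Z\<^esub> s) \<odot>\<^bsub>?N\<^esub> m = (a \<oplus>\<^bsub>?S\<^esub> c) \<odot>\<^bsub>M\<^esub> m \<ominus>\<^bsub>M\<^esub> (b \<oplus>\<^bsub>?S\<^esub> d) \<odot>\<^bsub>M\<^esub> m"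
    proof (rule diff)
      show "r \<oplus>\<^bsub>?Z\<^esub> s \<oplus>\<^bsub>?Z\<^esub> (b \<oplus>\<^bsub>?S\<^esub> d) = a \<oplus>\<^bsub>?S\<^esub> c"
        unfolding nonneg_group_semiring_simps ab(3)[symmetric] cd(3)[symmetric]
        using * Zcar by (simp add: Z.a_ac)
    qed (use * m ab cd in simp_all)
    then show "(r \<oplus>\<^bsub>?Z\<^esub> s) \<odot>\<^bsub>?N\<^esub> m = r \<odot>\<^bsub>?N\<^esub> m \<oplus>\<^bsub>?N\<^esub> s \<odot>\<^bsub>?N\<^esub> m"
      using m ab(1,2) cd(1,2) r[OF m] s
      by (simp add: int_extension_simps(3) M.smult_l_distr M.diff_add_diff)
    have "(r \<otimes>\<^bsub>?Z\<^esub> s) \<odot>\<^bsub>?N\<^esub> m =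
        (a \<otimes>\<^bsub>?S\<^esub> c \<oplus>\<^bsub>?S\<^esub> b \<otimes>\<^bsub>?S\<^esub> d) \<odot>\<^bsub>M\<^esub> m \<ominus>\<^bsub>M\<^esub> (a \<otimes>\<^bsub>?S\<^esub> d \<oplus>\<^bsub>?S\<^esub> b \<otimes>\<^bsub>?S\<^esub> c) \<odot>\<^bsub>M\<^esub> m"
    proof (rule diff)
      show "r \<otimes>\<^bsub>?Z\<^esub> s \<oplus>\<^bsub>?Z\<^esub> (a \<otimes>\<^bsub>?S\<^esub> d \<oplus>\<^bsub>?S\<^esub> b \<otimes>\<^bsub>?S\<^esub> c) = a \<otimes>\<^bsub>?S\<^esub> c \<oplus>\<^bsub>?S\<^esub> b \<otimes>\<^bsub>?S\<^esub> d"
        unfolding nonneg_group_semiring_simps ab(3)[symmetric] cd(3)[symmetric]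
        using * Zcar by (simp add: Z.l_distr Z.r_distr Z.a_ac)
    qed (use * m ab cd in simp_all)
    then show "(r \<otimes>\<^bsub>?Z\<^esub> s) \<odot>\<^bsub>?N\<^esub> m = r \<odot>\<^bsub>?N\<^esub> (s \<odot>\<^bsub>?N\<^esub> m)"
      using m ab(1,2) cd(1,2)
      by (simp add: s r M.smult_l_distr M.smult_assoc M.smult_minus)
         (simp add: a_minus_def M.minus_add M.M.a_ac)
  next
    fix m assume "m \<in> carrier ?N"
    then have m: "m \<in> carrier M" by (simp add: int_extension_simps)
    show "\<zero>\<^bsub>?Z\<^esub> \<odot>\<^bsub>?N\<^esub> m = \<zero>\<^bsub>?N\<^esub>" "\<one>\<^bsub>?Z\<^esub> \<odot>\<^bsub>?N\<^esub> m = m"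
      using m int_extension_smult_nonneg[OF M, of "\<zero>\<^bsub>?S\<^esub>" m]
        int_extension_smult_nonneg[OF M, of "\<one>\<^bsub>?S\<^esub>" m]
      by (simp_all add: M.smult_l_null M.smult_one int_extension_simps(2) S)
  qed
qed

lemma (in group) int_extension_is_restriction:
  assumes "semiring_module (nonneg_group_semiring G) M"
  shows "is_restriction_of_scalars (nonneg_group_semiring G) M (int_extension M)"
  using int_extension_smult_nonneg[OF assms]
  by (simp add: is_restriction_of_scalars_def int_extension_simps)

text \<open>
  A subgroup stable under the non-negative elements is stable under their differences; conversely,
  the scalar \<open>-1\<close> provides negation.
\<close>

lemma (in group) stable_subgroup_restriction_iff:
  assumes M: "semiring_module (nonneg_group_semiring G) M"
    and N: "semiring_module (int_group_ring G) N"
    and MN: "is_restriction_of_scalars (nonneg_group_semiring G) M N"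
  shows "stable_subgroup H (nonneg_group_semiring G) M \<longleftrightarrow> subsemimodule H (int_group_ring G) N"
proof -
  let ?S = "nonneg_group_semiring G" and ?Z = "int_group_ring G"
  interpret M: semiring_module ?S M by (rule M)
  interpret N: semiring_module ?Z N by (rule N)
  interpret Z: ring ?Z by (rule ring_int_group_ring)
  have eqs: "carrier M = carrier N" "\<zero>\<^bsub>M\<^esub> = \<zero>\<^bsub>N\<^esub>"
    "\<And>m n. m \<in> carrier N \<Longrightarrow> n \<in> carrier N \<Longrightarrow> m \<oplus>\<^bsub>M\<^esub> n = m \<oplus>\<^bsub>N\<^esub> n"
    "\<And>s m. s \<in> carrier ?S \<Longrightarrow> m \<in> carrier N \<Longrightarrow> s \<odot>\<^bsub>M\<^esub> m = s \<odot>\<^bsub>N\<^esub> m"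
    using MN by (auto simp: is_restriction_of_scalars_def)
  have inv: "\<ominus>\<^bsub>M\<^esub> m = \<ominus>\<^bsub>N\<^esub> m" if "m \<in> carrier N" for m
    using that M.a_inv_closed[of m] M.l_neg[of m]
    by (intro N.minus_equality[symmetric]) (simp_all add: eqs)
  show ?thesis
  proof
    assume "stable_subgroup H ?S M"
    then have H: "H \<subseteq> carrier N" "\<zero>\<^bsub>N\<^esub> \<in> H" "\<And>a b. a \<in> H \<Longrightarrow> b \<in> H \<Longrightarrow> a \<oplus>\<^bsub>N\<^esub> b \<in> H"
      "\<And>a. a \<in> H \<Longrightarrow> \<ominus>\<^bsub>N\<^esub> a \<in> H" "\<And>s a. s \<in> carrier ?S \<Longrightarrow> a \<in> H \<Longrightarrow> s \<odot>\<^bsub>N\<^esub> a \<in> H"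
      unfolding M.stable_subgroup_iff subsemimodule_iff
      using eqs inv by (auto simp: subset_iff)
    have "f \<odot>\<^bsub>N\<^esub> h \<in> H" if f: "f \<in> carrier ?Z" and h: "h \<in> H" for f h
    proof -
      note pn = pos_neg_part_closed[OF f]
      have hN: "h \<in> carrier N" using H h by blast
      have "f \<odot>\<^bsub>N\<^esub> h \<oplus>\<^bsub>N\<^esub> neg_part f \<odot>\<^bsub>N\<^esub> h = pos_part f \<odot>\<^bsub>N\<^esub> h"
        unfolding add_neg_part[of G f, symmetric]
        using f hN nonneg_subset[OF pn(2)] by (simp add: N.smult_l_distr)
      then have "f \<odot>\<^bsub>N\<^esub> h = pos_part f \<odot>\<^bsub>N\<^esub> h \<oplus>\<^bsub>N\<^esub> \<ominus>\<^bsub>N\<^esub> (neg_part f \<odot>\<^bsub>N\<^esub> h)"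
        using f hN pn nonneg_subset by (metis N.add.inv_solve_right N.smult_closed)
      then show ?thesis using H h pn by simp
    qed
    then show "subsemimodule H ?Z N" using H by (simp add: subsemimodule_iff)
  next
    assume "subsemimodule H ?Z N"
    then have H: "H \<subseteq> carrier N" "\<zero>\<^bsub>N\<^esub> \<in> H" "\<And>a b. a \<in> H \<Longrightarrow> b \<in> H \<Longrightarrow> a \<oplus>\<^bsub>N\<^esub> b \<in> H"
      "\<And>s a. s \<in> carrier ?Z \<Longrightarrow> a \<in> H \<Longrightarrow> s \<odot>\<^bsub>N\<^esub> a \<in> H"
      unfolding subsemimodule_iff by auto
    have "\<ominus>\<^bsub>N\<^esub> h \<in> H" if h: "h \<in> H" for h
    proof -
      have hN: "h \<in> carrier N" using H h by blast
      have "(\<ominus>\<^bsub>?Z\<^esub> \<one>\<^bsub>?Z\<^esub>) \<odot>\<^bsub>N\<^esub> h \<oplus>\<^bsub>N\<^esub> \<one>\<^bsub>?Z\<^esub> \<odot>\<^bsub>N\<^esub> h = \<zero>\<^bsub>N\<^esub>"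
        using hN by (simp add: Z.l_neg N.smult_l_null flip: N.smult_l_distr)
      then have "\<ominus>\<^bsub>N\<^esub> h = (\<ominus>\<^bsub>?Z\<^esub> \<one>\<^bsub>?Z\<^esub>) \<odot>\<^bsub>N\<^esub> h"
        using hN by (intro N.minus_equality) (simp_all add: N.smult_one)
      then show ?thesis using H(4) h by simp
    qed
    then show "stable_subgroup H ?S M"
      unfolding M.stable_subgroup_iff subsemimodule_iff
      using H eqs inv nonneg_subset[of _ G] by (auto simp: subset_iff)
  qed
qed

lemma (in group) elementary_iff_minimal_restriction:
  assumes M: "semiring_module (nonneg_group_semiring G) M"
    and N: "semiring_module (int_group_ring G) N"
    and MN: "is_restriction_of_scalars (nonneg_group_semiring G) M N"
  shows "elementary_semimodule (nonneg_group_semiring G) M \<longleftrightarrow> minimal_semimodule (int_group_ring G) N"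
  using MN semiring_module.axioms(1)[OF N]
  unfolding semiring_module.elementary_iff_no_stable_subgroup[OF M] minimal_semimodule_def
    stable_subgroup_restriction_iff[OF M N MN]
  by (auto simp: is_restriction_of_scalars_def)

section \<open>The equivalence of the four conditions\<close>

text \<open>
  Finiteness of \<open>G\<close> enters here: the semiring is then generated additively by the finite set of group
  elements, which bounds the exponent of \<open>M\<close>.
\<close>

lemma (in group) elementary_imp_minimal:
  assumes fin: "finite (carrier G)"
    and M: "semiring_module (nonneg_group_semiring G) M"
    and el: "elementary_semimodule (nonneg_group_semiring G) M"
  shows "minimal_semimodule (nonneg_group_semiring G) M"
proof -
  let ?S = "nonneg_group_semiring G"
  interpret M: semiring_module ?S M by (rule M)
  let ?X = "(\<lambda>g x. if x = g then 1 else 0) ` carrier G :: ('a \<Rightarrow> int) set"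
  have X: "finite ?X" using fin by simp
  have "?X \<subseteq> carrier ?S" by (auto simp: nonneg_group_semiring_def int_group_ring_def split: if_splits)
  from M.elementary_finitely_generated_additive[OF el X this nonneg_group_semiring_generated[OF fin]]
  obtain Y where "finite Y" "Y \<subseteq> carrier M" "generate (add_monoid M) Y = carrier M" by blast
  from M.elementary_imp_bounded_exponent[OF el this]
  obtain k :: nat where "0 < k" "\<And>m. m \<in> carrier M \<Longrightarrow> [k] \<cdot>\<^bsub>M\<^esub> m = \<zero>\<^bsub>M\<^esub>" by blast
  then show ?thesis by (rule M.bounded_exponent_elementary_imp_minimal[OF el])
qed

theorem theorem7p13:
  fixes G :: "('g, 'b) monoid_scheme"
    and M :: "('g \<Rightarrow> int, 'm) module"
  assumes "group G" and "finite (carrier G)"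
    and "semiring_module (nonneg_group_semiring G) M"
  shows "(minimal_semimodule (nonneg_group_semiring G) M \<longleftrightarrow>
            elementary_semimodule (nonneg_group_semiring G) M) \<and>
         (elementary_semimodule (nonneg_group_semiring G) M \<longleftrightarrow>
            simple_semimodule (nonneg_group_semiring G) M) \<and>
         (simple_semimodule (nonneg_group_semiring G) M \<longleftrightarrow>
            (\<exists>N :: ('g \<Rightarrow> int, 'm) module.
               semiring_module (int_group_ring G) N \<and>
               simple_semimodule (int_group_ring G) N \<and>
               is_restriction_of_scalars (nonneg_group_semiring G) M N))"
    (is "(?min \<longleftrightarrow> ?el) \<and> (?el \<longleftrightarrow> ?simple) \<and> (?simple \<longleftrightarrow> ?restr)")
proof -
  interpret group G by fact
  have min_el: "?min \<longleftrightarrow> ?el"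
    using semiring_module.minimal_imp_elementary[OF assms(3)]
      elementary_imp_minimal[OF assms(2,3)] by blast
  then have el_simple: "?el \<longleftrightarrow> ?simple" by (auto simp: simple_semimodule_def)
  have "?el \<longleftrightarrow> ?restr"
  proof
    assume ?el
    let ?N = "int_extension M"
    have N: "semiring_module (int_group_ring G) ?N"
      by (rule int_extension_semiring_module[OF assms(3)])
    have MN: "is_restriction_of_scalars (nonneg_group_semiring G) M ?N"
      by (rule int_extension_is_restriction[OF assms(3)])
    have "minimal_semimodule (int_group_ring G) ?N"
      using \<open>?el\<close> elementary_iff_minimal_restriction[OF assms(3) N MN] by blast
    then have "simple_semimodule (int_group_ring G) ?N"
      using semiring_module.minimal_imp_elementary[OF N] by (simp add: simple_semimodule_def)
    with N MN show ?restr by blast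
  next
    assume ?restr
    then show ?el
      using elementary_iff_minimal_restriction[OF assms(3)] by (auto simp: simple_semimodule_def)
  qed
  with min_el el_simple show ?thesis by blast
qed

end
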